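(* Let $(H_3,g)$ be the three-dimensional Heisenberg Lie group endowed with a left-invariant metric and let $F$ be a left-invariant Lorentz force on $H_3$. If $F\ne F_{0,\rho}$ for every $\rho\in\mathbb{R}$ (that is, $F$ does not vanish on the center of the Lie algebra), then there exist lattices $\Gamma\subset H_3$ such that every closed magnetic trajectory on $\Gamma\backslash H_3$ is contractible.
   Context: The Heisenberg group $H_3$ is $\mathbb{R}^3$ with product $(x_1,y_1,z_1)(x_2,y_2,z_2)=(x_1+x_2,\,y_1+y_2,\,z_1+z_2+\tfrac12(x_1y_2-x_2y_1))$; its Lie algebra $\mathfrak h_3$ has one-dimensional center $\mathfrak z$, with orthogonal complement $\mathfrak v=\mathfrak z^\perp$ for the metric. A left-invariant Lorentz force is a left-invariant skew-symmetric $(1,1)$-tensor $F$ (equivalently a skew-symmetric linear map of $\mathfrak h_3$) whose 2-form $g(F\cdot,\cdot)$ is closed. The forces denoted $F_{0,\rho}$ are those with $F(\mathfrak z)=0$ (for an orthonormal basis $e_1,e_2$ of $\mathfrak v$: $Fe_1=\rho e_2$, $Fe_2=-\rho e_1$, $F=0$ on $\mathfrak z$). A lattice is a discrete cocompact subgroup. The metric and $F$ descend to $\Gamma\backslash H_3$; a magnetic trajectory there is a curve $\gamma:\mathbb{R}\to\Gamma\backslash H_3$ with $\nabla_{\gamma'}\gamma'=F\gamma'$, and closed means periodic. It is contractible if the corresponding loop (over a period) is null-homotopic. *)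

theory Defs
  imports "HOL-Analysis.Analysis" "HOL-Algebra.Coset"
begin

section \<open>The Heisenberg group\<close>

definition heis :: "(real^3) monoid" where
  "heis = \<lparr>carrier = UNIV,
     monoid.mult = (\<lambda>p q. vector [p$1 + q$1, p$2 + q$2,
                         p$3 + q$3 + (p$1 * q$2 - q$1 * p$2) / 2]),
     one = 0\<rparr>"

text \<open>The differential at \<open>p\<close> of the left translation by \<open>a\<close>. Tangent vectors at all points
  are written in the global coordinates of \<open>real^3\<close>.\<close>

definition left_diff :: "real^3 \<Rightarrow> real^3 \<Rightarrow> real^3 \<Rightarrow> real^3" where
  "left_diff a p = frechet_derivative (\<lambda>q. a \<otimes>\<^bsub>heis\<^esub> q) (at p)"

definition left_field :: "real^3 \<Rightarrow> real^3 \<Rightarrow> real^3" where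
  "left_field u p = left_diff p \<one>\<^bsub>heis\<^esub> u"

definition field_bracket :: "(real^3 \<Rightarrow> real^3) \<Rightarrow> (real^3 \<Rightarrow> real^3) \<Rightarrow> real^3 \<Rightarrow> real^3" where
  "field_bracket X Y p =
     frechet_derivative Y (at p) (X p) - frechet_derivative X (at p) (Y p)"

text \<open>The Lie algebra is the tangent space at the identity.\<close>

definition lie_bracket :: "real^3 \<Rightarrow> real^3 \<Rightarrow> real^3" where
  "lie_bracket u v = field_bracket (left_field u) (left_field v) \<one>\<^bsub>heis\<^esub>"

definition lie_center :: "(real^3) set" where
  "lie_center = {z. \<forall>v. lie_bracket z v = 0}"


section \<open>Left-invariant metrics and Lorentz forces\<close>

text \<open>Smoothness of the tensor fields below is not required separately: a left-invariant tensor
  field is determined by its value at the identity and is automatically smooth.\<close>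

definition left_invariant_metric :: "(real^3 \<Rightarrow> real^3 \<Rightarrow> real^3 \<Rightarrow> real) \<Rightarrow> bool" where
  "left_invariant_metric g \<longleftrightarrow>
     (\<forall>p. bilinear (g p)) \<and>
     (\<forall>p u v. g p u v = g p v u) \<and>
     (\<forall>p u. u \<noteq> 0 \<longrightarrow> g p u u > 0) \<and>
     (\<forall>a p u v. g (a \<otimes>\<^bsub>heis\<^esub> p) (left_diff a p u) (left_diff a p v) = g p u v)"

text \<open>\<open>d\<omega> = 0\<close> for a 2-form \<open>\<omega>\<close>, with \<open>d\<omega>\<close> evaluated on constant coordinate fields.\<close>

definition closed_2form :: "(real^3 \<Rightarrow> real^3 \<Rightarrow> real^3 \<Rightarrow> real) \<Rightarrow> bool" where
  "closed_2form \<omega> \<longleftrightarrow>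
     (\<forall>p u v w. frechet_derivative (\<lambda>q. \<omega> q v w) (at p) u
              - frechet_derivative (\<lambda>q. \<omega> q u w) (at p) v
              + frechet_derivative (\<lambda>q. \<omega> q u v) (at p) w = 0)"

definition left_invariant_lorentz_force ::
    "(real^3 \<Rightarrow> real^3 \<Rightarrow> real^3 \<Rightarrow> real) \<Rightarrow> (real^3 \<Rightarrow> real^3 \<Rightarrow> real^3) \<Rightarrow> bool" where
  "left_invariant_lorentz_force g F \<longleftrightarrow>
     (\<forall>p. linear (F p)) \<and>
     (\<forall>a p u. F (a \<otimes>\<^bsub>heis\<^esub> p) (left_diff a p u) = left_diff a p (F p u)) \<and>
     (\<forall>p u v. g p (F p u) v = - g p u (F p v)) \<and>
     closed_2form (\<lambda>p u v. g p (F p u) v)"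

definition center_perp :: "(real^3 \<Rightarrow> real^3 \<Rightarrow> real^3 \<Rightarrow> real) \<Rightarrow> (real^3) set" where
  "center_perp g = {v. \<forall>z\<in>lie_center. g \<one>\<^bsub>heis\<^esub> v z = 0}"

text \<open>The left-invariant force \<open>F\<close> is of the form $F_{0,\rho}$, expressed at the identity. Reversing
  the orientation of the orthonormal basis replaces \<open>\<rho>\<close> by \<open>-\<rho>\<close>.\<close>

definition is_force_F0 ::
    "(real^3 \<Rightarrow> real^3 \<Rightarrow> real^3 \<Rightarrow> real) \<Rightarrow> real \<Rightarrow> (real^3 \<Rightarrow> real^3 \<Rightarrow> real^3) \<Rightarrow> bool" where
  "is_force_F0 g \<rho> F \<longleftrightarrow>
     (\<forall>z\<in>lie_center. F \<one>\<^bsub>heis\<^esub> z = 0) \<and>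
     (\<exists>e1 e2. span {e1, e2} = center_perp g \<and>
        g \<one>\<^bsub>heis\<^esub> e1 e1 = 1 \<and> g \<one>\<^bsub>heis\<^esub> e2 e2 = 1 \<and> g \<one>\<^bsub>heis\<^esub> e1 e2 = 0 \<and>
        F \<one>\<^bsub>heis\<^esub> e1 = \<rho> *\<^sub>R e2 \<and> F \<one>\<^bsub>heis\<^esub> e2 = - \<rho> *\<^sub>R e1)"


section \<open>Magnetic trajectories\<close>

text \<open>The covariant derivative \<open>\<nabla>\<^sub>u v\<close> at \<open>p\<close> of the constant coordinate field \<open>v\<close> in the
  direction \<open>u\<close>, for the Levi-Civita connection of \<open>g\<close>. It is given by the Koszul formula, whose
  bracket terms vanish for constant fields; that is, \<open>\<Sum>\<^sub>i\<^sub>j \<Gamma>\<^sup>k\<^sub>i\<^sub>j u\<^sub>i v\<^sub>j\<close> with the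
  usual Christoffel symbols.\<close>

definition christoffel ::
    "(real^3 \<Rightarrow> real^3 \<Rightarrow> real^3 \<Rightarrow> real) \<Rightarrow> real^3 \<Rightarrow> real^3 \<Rightarrow> real^3 \<Rightarrow> real^3" where
  "christoffel g p u v = (THE c. \<forall>w. 2 * g p c w =
       frechet_derivative (\<lambda>q. g q v w) (at p) u
     + frechet_derivative (\<lambda>q. g q u w) (at p) v
     - frechet_derivative (\<lambda>q. g q u v) (at p) w)"

text \<open>\<open>\<nabla>\<^bsub>\<sigma>'\<^esub> \<sigma>' = F \<sigma>'\<close> on the open set \<open>I\<close>, with \<open>v = \<sigma>'\<close> and \<open>a = \<sigma>''\<close>. Twice differentiable
  solutions of this equation are smooth.\<close>

definition magnetic_on ::
    "(real^3 \<Rightarrow> real^3 \<Rightarrow> real^3 \<Rightarrow> real) \<Rightarrow> (real^3 \<Rightarrow> real^3 \<Rightarrow> real^3) \<Rightarrow>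
     real set \<Rightarrow> (real \<Rightarrow> real^3) \<Rightarrow> bool" where
  "magnetic_on g F I \<sigma> \<longleftrightarrow>
     (\<exists>v a. \<forall>t\<in>I. (\<sigma> has_vector_derivative v t) (at t) \<and>
                  (v has_vector_derivative a t) (at t) \<and>
                  a t + christoffel g (\<sigma> t) (v t) (v t) = F (\<sigma> t) (v t))"


section \<open>Compact quotients\<close>

text \<open>The points of \<open>\<Gamma>\H\<^sub>3\<close> are the right cosets \<open>\<Gamma>p\<close>; the space carries the quotient topology.\<close>

definition heis_quotient :: "(real^3) set \<Rightarrow> (real^3) set topology" where
  "heis_quotient \<Gamma> =
     topology (\<lambda>U. U \<subseteq> rcosets\<^bsub>heis\<^esub> \<Gamma> \<and> open {p. \<Gamma> #>\<^bsub>heis\<^esub> p \<in> U})"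

lemma openin_heis_quotient:
  "openin (heis_quotient \<Gamma>) U \<longleftrightarrow> U \<subseteq> rcosets\<^bsub>heis\<^esub> \<Gamma> \<and> open {p. \<Gamma> #>\<^bsub>heis\<^esub> p \<in> U}"
proof -
  have "istopology (\<lambda>U. U \<subseteq> rcosets\<^bsub>heis\<^esub> \<Gamma> \<and> open {p. \<Gamma> #>\<^bsub>heis\<^esub> p \<in> U})"
    unfolding istopology_def
  proof (rule conjI; intro allI impI)
    fix S T
    assume S: "S \<subseteq> rcosets\<^bsub>heis\<^esub> \<Gamma> \<and> open {p. \<Gamma> #>\<^bsub>heis\<^esub> p \<in> S}"
      and T: "T \<subseteq> rcosets\<^bsub>heis\<^esub> \<Gamma> \<and> open {p. \<Gamma> #>\<^bsub>heis\<^esub> p \<in> T}"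
    have "{p. \<Gamma> #>\<^bsub>heis\<^esub> p \<in> S \<inter> T} = {p. \<Gamma> #>\<^bsub>heis\<^esub> p \<in> S} \<inter> {p. \<Gamma> #>\<^bsub>heis\<^esub> p \<in> T}" by blast
    with S T show "S \<inter> T \<subseteq> rcosets\<^bsub>heis\<^esub> \<Gamma> \<and> open {p. \<Gamma> #>\<^bsub>heis\<^esub> p \<in> S \<inter> T}"
      by (metis (lifting) inf.coboundedI1 open_Int)
  next
    fix K
    assume K: "\<forall>S\<in>K. S \<subseteq> rcosets\<^bsub>heis\<^esub> \<Gamma> \<and> open {p. \<Gamma> #>\<^bsub>heis\<^esub> p \<in> S}"
    have "{p. \<Gamma> #>\<^bsub>heis\<^esub> p \<in> \<Union>K} = (\<Union>S\<in>K. {p. \<Gamma> #>\<^bsub>heis\<^esub> p \<in> S})" by blast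
    moreover have "open (\<Union>S\<in>K. {p. \<Gamma> #>\<^bsub>heis\<^esub> p \<in> S})" using K by blast
    ultimately show "\<Union>K \<subseteq> rcosets\<^bsub>heis\<^esub> \<Gamma> \<and> open {p. \<Gamma> #>\<^bsub>heis\<^esub> p \<in> \<Union>K}"
      using K by (metis (lifting) Sup_least)
  qed
  then show ?thesis by (simp add: heis_quotient_def topology_inverse')
qed

definition heis_lattice :: "(real^3) set \<Rightarrow> bool" where
  "heis_lattice \<Gamma> \<longleftrightarrow> subgroup \<Gamma> heis \<and> discrete \<Gamma> \<and> compact_space (heis_quotient \<Gamma>)"

text \<open>The projection from \<open>H\<^sub>3\<close> is a local diffeomorphism under which \<open>g\<close> and \<open>F\<close> descend, so
  its local sections are charts of the quotient, and in such a chart the equation on the quotient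
  is the equation on \<open>H\<^sub>3\<close>.\<close>

definition quotient_magnetic_trajectory ::
    "(real^3 \<Rightarrow> real^3 \<Rightarrow> real^3 \<Rightarrow> real) \<Rightarrow> (real^3 \<Rightarrow> real^3 \<Rightarrow> real^3) \<Rightarrow>
     (real^3) set \<Rightarrow> (real \<Rightarrow> (real^3) set) \<Rightarrow> bool" where
  "quotient_magnetic_trajectory g F \<Gamma> \<gamma> \<longleftrightarrow>
     (\<forall>t. \<exists>\<epsilon>>0. \<exists>\<sigma>. magnetic_on g F {t - \<epsilon> <..< t + \<epsilon>} \<sigma> \<and>
                   (\<forall>s\<in>{t - \<epsilon> <..< t + \<epsilon>}. \<gamma> s = \<Gamma> #>\<^bsub>heis\<^esub> \<sigma> s))"

definition is_period :: "real \<Rightarrow> (real \<Rightarrow> 'a) \<Rightarrow> bool" where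
  "is_period T \<gamma> \<longleftrightarrow> T > 0 \<and> (\<forall>t. \<gamma> (t + T) = \<gamma> t)"

text \<open>Null-homotopic through loops, as in \<^const>\<open>homotopic_loops\<close>, which is only available for
  subsets of a topological type.\<close>

definition null_homotopic_loop :: "'a topology \<Rightarrow> (real \<Rightarrow> 'a) \<Rightarrow> bool" where
  "null_homotopic_loop X c \<longleftrightarrow>
     (\<exists>x. homotopic_with (\<lambda>r. r 1 = r 0) (top_of_set {0..1}) X c (\<lambda>_. x))"

end

theory Submission
  imports Defs
begin

text \<open>Noether's theorem for the right-invariant Killing fields turns the magnetic equation into
  conserved momenta: with \<open>\<Omega>(u, v) = g(Fu, v)\<close> at the identity and \<open>e3\<close> spanning the center, the
  quantity \<open>g(\<sigma>', w) - c area(\<sigma>, w) - \<Omega>(\<sigma>, w)\<close> is constant along a trajectory \<open>\<sigma>\<close> for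
  every constant coordinate field \<open>w\<close>. If \<open>\<sigma>(t + T) = d \<sigma>(t)\<close>, the momentum of \<open>e3\<close> gives
  \<open>\<Omega>(d, e3) = 0\<close>. As \<open>F\<close> does not vanish on the center, \<open>\<Omega>(\<cdot>, e3)\<close> is a nonzero functional of the
  first two coordinates, and for a lattice whose projection meets the kernel of this functional
  only in 0 the translation \<open>d\<close> is central. Then the other momenta give \<open>\<Omega>(d, w) = 0\<close> for all
  \<open>w\<close>, hence \<open>d = 0\<close>: the lift of a closed trajectory is a loop in the contractible space \<open>H\<^sub>3\<close>.\<close>

section \<open>The group law and left-invariant metrics\<close>

abbreviation e3 :: "real^3" where "e3 \<equiv> axis 3 1"

text \<open>The cocycle of the Heisenberg group as a central extension of the plane. Taken as a
  bilinear form on all of \<open>real^3\<close> with \<open>e3\<close> in its radical, it turns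
  products and differentials into linear algebra.\<close>

definition area_form :: "real^3 \<Rightarrow> real^3 \<Rightarrow> real" where
  "area_form u v = (u$1 * v$2 - v$1 * u$2) / 2"

lemma bilinear_area_form: "bilinear area_form"
  unfolding bilinear_def by (auto intro!: linearI simp: area_form_def field_simps)

lemma bounded_bilinear_area_form: "bounded_bilinear area_form"
  using bilinear_area_form bilinear_conv_bounded_bilinear by blast

interpretation area: bounded_bilinear area_form by (rule bounded_bilinear_area_form)

lemma area_form_self [simp]: "area_form u u = 0"
  by (simp add: area_form_def)

lemma area_form_e3 [simp]: "area_form u e3 = 0" "area_form e3 u = 0"
  by (simp_all add: area_form_def axis_def)

lemma area_form_commute: "area_form u v = - area_form v u"
  by (simp add: area_form_def field_simps)

lemma vec3_eq_iff: "(u::real^3) = v \<longleftrightarrow> u$1 = v$1 \<and> u$2 = v$2 \<and> u$3 = v$3"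
  by (simp add: vec_eq_iff forall_3)

lemma vec3_expand: "(u::real^3) = u$1 *\<^sub>R axis 1 1 + u$2 *\<^sub>R axis 2 1 + u$3 *\<^sub>R e3"
  by (simp add: vec3_eq_iff axis_def)

lemma heis_mult: "p \<otimes>\<^bsub>heis\<^esub> q = p + q + area_form p q *\<^sub>R e3"
  by (simp add: heis_def vec3_eq_iff area_form_def axis_def)

lemma heis_one [simp]: "\<one>\<^bsub>heis\<^esub> = 0" and heis_carrier [simp]: "carrier heis = UNIV"
  by (simp_all add: heis_def)

lemma heis_mult_0 [simp]: "p \<otimes>\<^bsub>heis\<^esub> 0 = p" "0 \<otimes>\<^bsub>heis\<^esub> p = p"
  by (simp_all add: heis_mult area.zero_left area.zero_right)

lemma group_heis: "group heis"
proof (rule groupI)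
  show "\<exists>y\<in>carrier heis. y \<otimes>\<^bsub>heis\<^esub> x = \<one>\<^bsub>heis\<^esub>" for x
    by (rule bexI[of _ "- x"]) (simp_all add: heis_mult area.minus_left)
qed (simp_all add: heis_mult area.add_left area.add_right area.scaleR_left area.scaleR_right algebra_simps
       area.zero_left)

interpretation heis: group heis by (rule group_heis)

lemma heis_inv: "inv\<^bsub>heis\<^esub> x = - x"
  by (rule heis.inv_equality) (simp_all add: heis_mult area.minus_left)

lemma left_diff: "left_diff a p u = u + area_form a u *\<^sub>R e3"
proof -
  have *: "((\<lambda>q. a \<otimes>\<^bsub>heis\<^esub> q) has_derivative (\<lambda>u. u + area_form a u *\<^sub>R e3)) (at p)"
    unfolding heis_mult
    by (auto intro!: derivative_eq_intros bounded_linear.has_derivative[OF area.bounded_linear_right])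
  show ?thesis
    unfolding left_diff_def frechet_derivative_at[OF *, symmetric] ..
qed

lemma left_field: "left_field u p = u + area_form p u *\<^sub>R e3"
  by (simp add: left_field_def left_diff)

lemma lie_bracket: "lie_bracket u v = (2 * area_form u v) *\<^sub>R e3"
proof -
  have *: "frechet_derivative (left_field w) (at p) = (\<lambda>x. area_form x w *\<^sub>R e3)" for w p
  proof -
    have *: "(left_field w has_derivative (\<lambda>x. area_form x w *\<^sub>R e3)) (at p)"
      unfolding left_field[abs_def]
      by (auto intro!: derivative_eq_intros bounded_linear.has_derivative[OF area.bounded_linear_left])
    show ?thesis
      by (rule frechet_derivative_at[OF *, symmetric])
  qed
  show ?thesis
    unfolding lie_bracket_def field_bracket_def * using area_form_commute[of v u]
    by (simp add: left_field area.zero_left scaleR_diff_left[symmetric] del: scaleR_minus_left)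
qed

lemma lie_center: "lie_center = {z. z$1 = 0 \<and> z$2 = 0}"
proof -
  have "z$1 = 0 \<and> z$2 = 0" if "\<forall>v. lie_bracket z v = 0" for z
  proof -
    have "area_form z (axis 2 1) = 0" "area_form z (axis 1 1) = 0"
      using that by (auto simp: lie_bracket)
    then show ?thesis by (simp add: area_form_def axis_def)
  qed
  then show ?thesis
    by (auto simp: lie_center_def lie_bracket area_form_def)
qed

text \<open>Riesz representation for a positive definite form: the map sending \<open>c\<close> to
  the Euclidean vector representing \<open>b c\<close> is injective by positivity, hence surjective
  by dimension. It supplies the vector that \<open>christoffel\<close> selects by
  \<open>THE\<close>.\<close>

lemma bilinear_representation:
  fixes b :: "'a::euclidean_space \<Rightarrow> 'a \<Rightarrow> real"
  assumes b: "bilinear b" and pos: "\<And>u. u \<noteq> 0 \<Longrightarrow> b u u > 0" and f: "linear f"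
  shows "\<exists>c. \<forall>w. b c w = f w"
proof -
  define T where "T c = (\<Sum>i\<in>Basis. b c i *\<^sub>R i)" for c
  have T_inner: "T c \<bullet> i = b c i" if "i \<in> Basis" for c i
    using that by (simp add: T_def inner_sum_left inner_Basis if_distrib cong: if_cong)
  have lin_l: "linear (\<lambda>c. b c w)" and lin_r: "linear (b c)" for c w
    using b by (auto simp: bilinear_def)
  have linT: "linear T"
    unfolding T_def using lin_l
    by (intro linear_compose_sum ballI linearI)
       (simp_all add: linear_add[OF lin_l] linear_scale[OF lin_l] scaleR_left_distrib)
  have "inj T"
    unfolding linear_injective_0[OF linT]
  proof (intro allI impI, rule ccontr)
    fix c assume "T c = 0" "c \<noteq> 0"
    then have "b c i = 0" if "i \<in> Basis" for i
      using T_inner[OF that, of c] by simp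
    then have "b c = (\<lambda>_. 0)"
      by (intro linear_eq_stdbasis[OF lin_r]) (auto intro: linear_zero)
    then show False using pos[OF \<open>c \<noteq> 0\<close>] by simp
  qed
  then have "surj T" using linT linear_injective_imp_surjective by blast
  then obtain c where c: "T c = (\<Sum>i\<in>Basis. f i *\<^sub>R i)" by (metis surjD)
  have "b c i = f i" if "i \<in> Basis" for i
    using T_inner[OF that, of c] that
    by (simp add: c inner_sum_left inner_Basis if_distrib cong: if_cong)
  then have "b c = f" by (intro linear_eq_stdbasis[OF lin_r f])
  then show ?thesis by auto
qed

section \<open>Left-invariant metrics and their Koszul formula\<close>

locale heis_metric =
  fixes g :: "real^3 \<Rightarrow> real^3 \<Rightarrow> real^3 \<Rightarrow> real"
  assumes metric: "left_invariant_metric g"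
begin

lemma bilinear_g: "bilinear (g p)" and g_commute: "g p u v = g p v u"
  and g_pos: "u \<noteq> 0 \<Longrightarrow> g p u u > 0"
  and g_left: "g (a \<otimes>\<^bsub>heis\<^esub> p) (left_diff a p u) (left_diff a p v) = g p u v"
  using metric unfolding left_invariant_metric_def by blast+

lemma bounded_bilinear_g: "bounded_bilinear (g p)"
  using bilinear_g bilinear_conv_bounded_bilinear by blast

sublocale g: bounded_bilinear "g p" for p by (rule bounded_bilinear_g)

lemma g_nondegenerate: "(\<And>w. g p u w = g p v w) \<Longrightarrow> u = v"
  using g_pos[of "u - v" p] by (force simp: g.diff_left)

text \<open>Subtracting the area terms inverts the differential of the translation by
  \<open>p\<close>, which carries both vectors back to the identity.\<close>

lemma g_translate: "g p u v = g 0 (u - area_form p u *\<^sub>R e3) (v - area_form p v *\<^sub>R e3)"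
  using g_left[of p 0 "u - area_form p u *\<^sub>R e3" "v - area_form p v *\<^sub>R e3"]
  by (simp add: heis_mult left_diff area.zero_right area.diff_right area.scaleR_right)

text \<open>The metric coefficients become explicit polynomials of degree at most two in
  \<open>p\<close>, ready to be differentiated.\<close>

lemma g_expand: "g p u v = g 0 u v - area_form p u * g 0 e3 v - area_form p v * g 0 e3 u
    + area_form p u * area_form p v * g 0 e3 e3"
  unfolding g_translate[of p] using g_commute[of 0 u e3]
  by (simp add: g.diff_left g.diff_right g.scaleR_left g.scaleR_right algebra_simps)

lemma frechet_derivative_g:
  "frechet_derivative (\<lambda>q. g q u v) (at p) x = - area_form x u * g p e3 v - area_form x v * g p e3 u"
proof -
  have "(\<lambda>q. g q u v) = (\<lambda>q. g 0 u v - area_form q u * g 0 e3 v - area_form q v * g 0 e3 u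
      + area_form q u * area_form q v * g 0 e3 e3)"
    by (rule ext) (rule g_expand)
  then have *: "((\<lambda>q. g q u v) has_derivative
      (\<lambda>x. - area_form x u * g p e3 v - area_form x v * g p e3 u)) (at p)"
    unfolding g_expand[of p e3]
    by (auto intro!: derivative_eq_intros bounded_linear.has_derivative[OF area.bounded_linear_left]
        simp: algebra_simps)
  show ?thesis
    unfolding frechet_derivative_at[OF *, symmetric] ..
qed

text \<open>The first two Koszul terms contribute \<open>- area_form v w * g p e3 v\<close> each and
  the third twice that. The vector described by \<open>THE\<close> is unique by nondegeneracy and
  exists by \<open>bilinear_representation\<close>.\<close>

lemma g_christoffel: "g p (christoffel g p v v) w = - 2 * area_form v w * g p e3 v"
proof -
  have koszul: "(\<forall>w. 2 * g p c w =
       frechet_derivative (\<lambda>q. g q v w) (at p) v + frechet_derivative (\<lambda>q. g q v w) (at p) v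
     - frechet_derivative (\<lambda>q. g q v v) (at p) w) \<longleftrightarrow>
     (\<forall>w. g p c w = - 2 * area_form v w * g p e3 v)" for c
  proof -
    have "(2 * g p c w = frechet_derivative (\<lambda>q. g q v w) (at p) v
        + frechet_derivative (\<lambda>q. g q v w) (at p) v - frechet_derivative (\<lambda>q. g q v v) (at p) w) \<longleftrightarrow>
      g p c w = - 2 * area_form v w * g p e3 v" for w
      unfolding frechet_derivative_g using area_form_commute[of w v] by auto
    then show ?thesis by blast
  qed
  have "linear (\<lambda>w. - 2 * area_form v w * g p e3 v)"
    by (auto intro!: linearI simp: area.add_right area.scaleR_right algebra_simps)
  then obtain c where c: "\<forall>w. g p c w = - 2 * area_form v w * g p e3 v"
    using bilinear_representation[OF bilinear_g g_pos] by blast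
  then have "christoffel g p v v = c"
    unfolding christoffel_def koszul by (intro the_equality) (auto intro: g_nondegenerate[of p])
  then show ?thesis using c by simp
qed

end

section \<open>Magnetic trajectories and their conserved momenta\<close>

locale heis_magnetic = heis_metric +
  fixes F :: "real^3 \<Rightarrow> real^3 \<Rightarrow> real^3"
  assumes force: "left_invariant_lorentz_force g F"
begin

definition Om :: "real^3 \<Rightarrow> real^3 \<Rightarrow> real" where "Om u v = g 0 (F 0 u) v"

lemma linear_F: "linear (F p)"
  and F_left: "F (a \<otimes>\<^bsub>heis\<^esub> p) (left_diff a p u) = left_diff a p (F p u)"
  and F_skew: "g p (F p u) v = - g p u (F p v)"
  using force unfolding left_invariant_lorentz_force_def by blast+

lemma Om_skew: "Om u v = - Om v u"
  unfolding Om_def F_skew[of 0 u v] by (simp add: g_commute)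

lemma bilinear_Om: "bilinear Om"
  unfolding bilinear_def Om_def
  by (auto intro!: linearI simp: linear_add[OF linear_F] linear_scale[OF linear_F]
      g.add_left g.add_right g.scaleR_left g.scaleR_right)

sublocale Om: bounded_bilinear Om
  using bilinear_Om bilinear_conv_bounded_bilinear by blast

lemma Om_self [simp]: "Om u u = 0"
  using Om_skew[of u u] by simp

text \<open>By skewness \<open>e3\<close> itself drops out, so the functional factors through the
  projection to the plane.\<close>

lemma Om_e3: "Om u e3 = u$1 * Om (axis 1 1) e3 + u$2 * Om (axis 2 1) e3"
  by (subst vec3_expand[of u]) (simp add: Om.add_left Om.scaleR_left)

lemma g_F: "g p (F p u) v = Om (u - area_form p u *\<^sub>R e3) (v - area_form p v *\<^sub>R e3)"
proof -
  have "F p u = left_diff p 0 (F 0 (u - area_form p u *\<^sub>R e3))"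
    using F_left[of p 0 "u - area_form p u *\<^sub>R e3"]
    by (simp add: heis_mult left_diff area.zero_right area.diff_right area.scaleR_right)
  then show ?thesis
    unfolding Om_def g_translate[of p] by (simp add: left_diff area.add_right area.scaleR_right)
qed

text \<open>The weak form of the equation: testing against every \<open>w\<close> replaces the
  vector \<open>christoffel\<close> by its known inner products.\<close>

lemma magnetic_equation:
  "a + christoffel g p v v = F p v \<longleftrightarrow>
     (\<forall>w. g p a w - 2 * area_form v w * g p e3 v = g p (F p v) w)"
proof
  assume "\<forall>w. g p a w - 2 * area_form v w * g p e3 v = g p (F p v) w"
  then show "a + christoffel g p v v = F p v"
    by (intro g_nondegenerate[of p]) (simp add: g.add_left g_christoffel)
qed (auto simp: g_christoffel g.add_left dest!: sym[of _ "F p v"])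

text \<open>Left translations are isometries commuting with \<open>F\<close>. In the weak form it
  remains to match the test vectors under the differential, which fixes \<open>e3\<close> and
  preserves \<open>area_form\<close>.\<close>

lemma magnetic_equation_translate:
  assumes "a + christoffel g p v v = F p v"
  shows "left_diff d p a + christoffel g (d \<otimes>\<^bsub>heis\<^esub> p) (left_diff d p v) (left_diff d p v)
    = F (d \<otimes>\<^bsub>heis\<^esub> p) (left_diff d p v)"
  unfolding magnetic_equation
proof
  fix w
  define w' where "w' = w - area_form d w *\<^sub>R e3"
  have w: "w = left_diff d p w'"
    by (simp add: w'_def left_diff area.diff_right area.scaleR_right)
  have e3: "g (d \<otimes>\<^bsub>heis\<^esub> p) e3 (left_diff d p v) = g p e3 v"
    using g_left[of d p e3 v] by (simp add: left_diff)
  have area_form: "area_form (left_diff d p v) (left_diff d p w') = area_form v w'"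
    by (simp add: left_diff area.add_left area.add_right area.scaleR_left area.scaleR_right)
  have "g p a w' - 2 * area_form v w' * g p e3 v = g p (F p v) w'"
    using assms unfolding magnetic_equation by blast
  then show "g (d \<otimes>\<^bsub>heis\<^esub> p) (left_diff d p a) w
      - 2 * area_form (left_diff d p v) w * g (d \<otimes>\<^bsub>heis\<^esub> p) e3 (left_diff d p v)
      = g (d \<otimes>\<^bsub>heis\<^esub> p) (F (d \<otimes>\<^bsub>heis\<^esub> p) (left_diff d p v)) w"
    unfolding w area_form F_left g_left e3 .
qed

section \<open>Translating, restricting and gluing trajectories\<close>

lemma magnetic_on_translate:
  assumes "magnetic_on g F I \<sigma>"
  shows "magnetic_on g F I (\<lambda>t. d \<otimes>\<^bsub>heis\<^esub> \<sigma> t)"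
proof -
  obtain v a where va: "\<And>t. t \<in> I \<Longrightarrow> (\<sigma> has_vector_derivative v t) (at t)"
    "\<And>t. t \<in> I \<Longrightarrow> (v has_vector_derivative a t) (at t)"
    "\<And>t. t \<in> I \<Longrightarrow> a t + christoffel g (\<sigma> t) (v t) (v t) = F (\<sigma> t) (v t)"
    using assms unfolding magnetic_on_def by blast
  have area_form: "((\<lambda>t. area_form d (f t)) has_real_derivative area_form d f') (at t)"
    if "(f has_vector_derivative f') (at t)" for f f' and t :: real
    using bounded_linear.has_vector_derivative[OF area.bounded_linear_right that]
    by (simp add: has_real_derivative_iff_has_vector_derivative)
  show ?thesis
    unfolding magnetic_on_def
  proof (rule exI[of _ "\<lambda>t. left_diff d (\<sigma> t) (v t)"],
      rule exI[of _ "\<lambda>t. left_diff d (\<sigma> t) (a t)"], intro ballI conjI)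
    fix t assume t: "t \<in> I"
    show "((\<lambda>t. d \<otimes>\<^bsub>heis\<^esub> \<sigma> t) has_vector_derivative left_diff d (\<sigma> t) (v t)) (at t)"
      unfolding left_diff heis_mult
      by (auto intro!: derivative_eq_intros va(1) area_form t)
    show "((\<lambda>t. left_diff d (\<sigma> t) (v t)) has_vector_derivative left_diff d (\<sigma> t) (a t)) (at t)"
      unfolding left_diff
      by (auto intro!: derivative_eq_intros va(2) area_form t)
  qed (rule magnetic_equation_translate[OF va(3)])
qed

lemma magnetic_on_cong:
  assumes "magnetic_on g F I \<sigma>" "open I" "\<And>t. t \<in> I \<Longrightarrow> \<sigma> t = \<tau> t"
  shows "magnetic_on g F I \<tau>"
proof -
  obtain v a where va: "\<And>t. t \<in> I \<Longrightarrow> (\<sigma> has_vector_derivative v t) (at t)"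
    "\<And>t. t \<in> I \<Longrightarrow> (v has_vector_derivative a t) (at t)"
    "\<And>t. t \<in> I \<Longrightarrow> a t + christoffel g (\<sigma> t) (v t) (v t) = F (\<sigma> t) (v t)"
    using assms(1) unfolding magnetic_on_def by blast
  have "(\<tau> has_vector_derivative v t) (at t)" if "t \<in> I" for t
    using has_vector_derivative_transform_within_open[OF va(1)[OF that] assms(2) that assms(3)] .
  then show ?thesis
    unfolding magnetic_on_def using va(2,3) assms(3)
    by (intro exI[of _ v] exI[of _ a]) simp
qed

lemma magnetic_on_subset: "magnetic_on g F I \<sigma> \<Longrightarrow> J \<subseteq> I \<Longrightarrow> magnetic_on g F J \<sigma>"
  unfolding magnetic_on_def by blast

text \<open>The velocity and acceleration witnesses on \<open>I\<close> and \<open>J\<close> are a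
  priori unrelated. Replacing both by the canonical \<open>vector_derivative\<close> gives one pair
  that serves the union.\<close>

lemma magnetic_on_Un:
  assumes I: "magnetic_on g F I \<sigma>" "open I" and J: "magnetic_on g F J \<sigma>" "open J"
  shows "magnetic_on g F (I \<union> J) \<sigma>"
proof -
  let ?v = "\<lambda>t. vector_derivative \<sigma> (at t)"
  have *: "(\<sigma> has_vector_derivative ?v t) (at t) \<and>
      (?v has_vector_derivative vector_derivative ?v (at t)) (at t) \<and>
      vector_derivative ?v (at t) + christoffel g (\<sigma> t) (?v t) (?v t) = F (\<sigma> t) (?v t)"
    if K: "magnetic_on g F K \<sigma>" "open K" and t: "t \<in> K" for K t
  proof -
    obtain v a where va: "\<And>t. t \<in> K \<Longrightarrow> (\<sigma> has_vector_derivative v t) (at t)"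
      "\<And>t. t \<in> K \<Longrightarrow> (v has_vector_derivative a t) (at t)"
      "\<And>t. t \<in> K \<Longrightarrow> a t + christoffel g (\<sigma> t) (v t) (v t) = F (\<sigma> t) (v t)"
      using K unfolding magnetic_on_def by blast
    have v: "v s = ?v s" if "s \<in> K" for s
      using vector_derivative_at[OF va(1)[OF that]] by simp
    have "(?v has_vector_derivative a t) (at t)"
      using has_vector_derivative_transform_within_open[OF va(2)[OF t] K(2) t v] .
    then show ?thesis
      using va(1,3)[OF t] vector_derivative_at[of ?v] unfolding v[OF t] by simp
  qed
  show ?thesis
    unfolding magnetic_on_def
    by (intro exI[of _ ?v] exI[of _ "\<lambda>t. vector_derivative ?v (at t)"] ballI)
       (use *[OF I] *[OF J] in blast)
qed

lemma has_derivative_zero_interval_constant: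
  fixes f :: "real \<Rightarrow> real"
  assumes "\<And>t. t \<in> {a<..<b} \<Longrightarrow> (f has_vector_derivative 0) (at t)"
  shows "\<exists>k. \<forall>t\<in>{a<..<b}. f t = k"
proof -
  have "f constant_on {a<..<b}"
  proof (intro has_derivative_zero_connected_constant_on[of _ "{}"] ballI)
    show "continuous_on {a<..<b} f"
      using assms by (meson continuous_at_imp_continuous_on has_vector_derivative_continuous)
    show "(f has_derivative (\<lambda>h. 0)) (at t within {a<..<b})" if "t \<in> {a<..<b} - {}" for t
      using assms[of t] that by (auto simp: has_vector_derivative_def intro: has_derivative_at_withinI)
  qed auto
  then show ?thesis by (auto simp: constant_on_def)
qed

text \<open>These are the Noether momenta of the right-invariant Killing fields, rewritten so that
  \<open>w\<close> is a constant coordinate field. The momentum of \<open>e3\<close> is the constant \<open>c\<close>, which enters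
  the other ones.\<close>

lemma momentum_conserved:
  assumes "magnetic_on g F {a<..<b} \<sigma>"
  obtains v c where "\<And>t. t \<in> {a<..<b} \<Longrightarrow> (\<sigma> has_vector_derivative v t) (at t)"
    and "\<And>w. \<exists>k. \<forall>t\<in>{a<..<b}. g (\<sigma> t) (v t) w - c * area_form (\<sigma> t) w - Om (\<sigma> t) w = k"
proof -
  let ?I = "{a<..<b}"
  obtain v a where va: "\<And>t. t \<in> ?I \<Longrightarrow> (\<sigma> has_vector_derivative v t) (at t)"
    "\<And>t. t \<in> ?I \<Longrightarrow> (v has_vector_derivative a t) (at t)"
    "\<And>t. t \<in> ?I \<Longrightarrow> a t + christoffel g (\<sigma> t) (v t) (v t) = F (\<sigma> t) (v t)"
    using assms unfolding magnetic_on_def by blast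
  have area_form: "((\<lambda>t. area_form (\<sigma> t) (f t)) has_vector_derivative area_form (v t) (f t) + area_form (\<sigma> t) f') (at t)"
    if "t \<in> ?I" "(f has_vector_derivative f') (at t)" for f f' t
    using bounded_bilinear.has_vector_derivative[OF bounded_bilinear_area_form va(1)[OF that(1)] that(2)]
    by (simp add: add.commute)
  have lin: "((\<lambda>t. g 0 u (f t)) has_vector_derivative g 0 u f') (at t)"
    if "(f has_vector_derivative f') (at t)" for u f f' and t :: real
    using bounded_linear.has_vector_derivative[OF g.bounded_linear_right that] .
  have lin': "((\<lambda>t. g 0 (f t) u) has_vector_derivative g 0 f' u) (at t)"
    if "(f has_vector_derivative f') (at t)" for u f f' and t :: real
    using bounded_linear.has_vector_derivative[OF g.bounded_linear_left that] .
  have linO: "((\<lambda>t. Om (\<sigma> t) w) has_vector_derivative Om (v t) w) (at t)" if "t \<in> ?I" for w t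
    using bounded_linear.has_vector_derivative[OF Om.bounded_linear_left va(1)[OF that]] .
  \<comment> \<open>Besides the acceleration, the moving base point contributes the derivative of
    the metric along \<open>v\<close>, which is
    \<open>- area_form (v t) w * g (\<sigma> t) e3 (v t)\<close> because
    \<open>area_form (v t) (v t)\<close> vanishes. The equation then eliminates the
    acceleration.\<close>
  have mom: "((\<lambda>t. g (\<sigma> t) (v t) w) has_vector_derivative
      g (\<sigma> t) (F (\<sigma> t) (v t)) w + area_form (v t) w * g (\<sigma> t) e3 (v t)) (at t)" if t: "t \<in> ?I" for w t
  proof -
    have "g (\<sigma> t) (a t) w = g (\<sigma> t) (F (\<sigma> t) (v t)) w + 2 * area_form (v t) w * g (\<sigma> t) e3 (v t)"
      using va(3)[OF t] unfolding magnetic_equation by (auto simp: algebra_simps)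
    moreover have "((\<lambda>t. g (\<sigma> t) (v t) w) has_vector_derivative
      g (\<sigma> t) (a t) w - area_form (v t) w * g (\<sigma> t) e3 (v t)) (at t)"
      unfolding g_expand[of "\<sigma> _" _ w] g_expand[of "\<sigma> _" e3]
      using area_form[OF t va(2)[OF t]] area_form[OF t has_vector_derivative_const[of w]]
        lin[OF va(2)[OF t], of e3] lin'[OF va(2)[OF t], of w]
      by (auto intro!: derivative_eq_intros simp: area.zero_right algebra_simps)
    ultimately show ?thesis by (simp add: algebra_simps)
  qed
  \<comment> \<open>For \<open>e3\<close> all area terms vanish, so this momentum is conserved by
    itself and determines \<open>c\<close>.\<close>
  have "\<exists>c. \<forall>t\<in>?I. g (\<sigma> t) (v t) e3 - Om (\<sigma> t) e3 = c"
  proof (rule has_derivative_zero_interval_constant)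
    fix t assume t: "t \<in> ?I"
    have "g (\<sigma> t) (F (\<sigma> t) (v t)) e3 = Om (v t) e3"
      by (simp add: g_F Om.diff_left Om.scaleR_left)
    then show "((\<lambda>t. g (\<sigma> t) (v t) e3 - Om (\<sigma> t) e3) has_vector_derivative 0) (at t)"
      using mom[OF t, of e3] linO[OF t, of e3] by (auto intro!: derivative_eq_intros)
  qed
  then obtain c where c0: "\<And>t. t \<in> ?I \<Longrightarrow> g (\<sigma> t) (v t) e3 - Om (\<sigma> t) e3 = c"
    by blast
  have c: "g (\<sigma> t) e3 (v t) = c + Om (\<sigma> t) e3" if "t \<in> ?I" for t
    using c0[OF that] g_commute[of "\<sigma> t" e3 "v t"] by linarith
  have "\<exists>k. \<forall>t\<in>?I. g (\<sigma> t) (v t) w - c * area_form (\<sigma> t) w - Om (\<sigma> t) w = k" for w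
  proof (rule has_derivative_zero_interval_constant)
    fix t assume t: "t \<in> ?I"
    \<comment> \<open>Planar vectors satisfy area(s, v) w + area(v, w) s + area(w, s) v = 0.
      Applying the functional \<open>Om _ e3\<close> cancels the terms that still depend on the base
      point.\<close>
    have "area_form (\<sigma> t) (v t) * Om w e3 - area_form (\<sigma> t) w * Om (v t) e3 + area_form (v t) w * Om (\<sigma> t) e3 = 0"
      unfolding Om_e3[of w] Om_e3[of "v t"] Om_e3[of "\<sigma> t"] area_form_def by (simp add: field_simps)
    then have "g (\<sigma> t) (F (\<sigma> t) (v t)) w + area_form (v t) w * g (\<sigma> t) e3 (v t)
        = c * area_form (v t) w + Om (v t) w"
      unfolding g_F c[OF t] using Om_skew[of e3 w]
      by (simp add: Om.diff_left Om.diff_right Om.scaleR_left Om.scaleR_right algebra_simps)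
    then show "((\<lambda>t. g (\<sigma> t) (v t) w - c * area_form (\<sigma> t) w - Om (\<sigma> t) w) has_vector_derivative 0) (at t)"
      using mom[OF t, of w] linO[OF t, of w] area_form[OF t has_vector_derivative_const[of w]]
      by (auto intro!: derivative_eq_intros simp: area.zero_right)
  qed
  with va(1) show thesis by (rule that)
qed

text \<open>Momenta are compared at the times 0 and \<open>T\<close>, and the margin
  \<open>e\<close> makes velocities available at both. The lattice will supply \<open>irr\<close>;
  \<open>nz\<close> says that \<open>F\<close> does not vanish on the center.\<close>

lemma deck_translation_trivial:
  assumes mag: "magnetic_on g F {-e<..<T + e} \<sigma>" and pos: "e > 0" "T > 0"
    and deck: "\<And>s. s \<in> {-e<..<e} \<Longrightarrow> \<sigma> (s + T) = d \<otimes>\<^bsub>heis\<^esub> \<sigma> s"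
    and irr: "Om d e3 = 0 \<Longrightarrow> d$1 = 0 \<and> d$2 = 0"
    and nz: "\<exists>u. Om e3 u \<noteq> 0"
  shows "d = 0"
proof -
  obtain v c where v: "\<And>t. t \<in> {-e<..<T + e} \<Longrightarrow> (\<sigma> has_vector_derivative v t) (at t)"
    and k: "\<And>w. \<exists>k. \<forall>t\<in>{-e<..<T + e}. g (\<sigma> t) (v t) w - c * area_form (\<sigma> t) w - Om (\<sigma> t) w = k"
    using momentum_conserved[OF mag] by blast
  have I: "0 \<in> {-e<..<T + e}" "T \<in> {-e<..<T + e}" using pos by auto
  have eq: "g (\<sigma> T) (v T) w - c * area_form (\<sigma> T) w - Om (\<sigma> T) w
    = g (\<sigma> 0) (v 0) w - c * area_form (\<sigma> 0) w - Om (\<sigma> 0) w" for w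
    using k[of w] I by metis
  have \<sigma>T: "\<sigma> T = d \<otimes>\<^bsub>heis\<^esub> \<sigma> 0" using deck[of 0] pos by simp
  \<comment> \<open>Differentiating the deck relation at 0 on both sides relates the velocities at 0
    and \<open>T\<close>.\<close>
  have "((\<lambda>s. \<sigma> (s + T)) has_vector_derivative v T) (at 0)"
  proof -
    have "((\<lambda>s. s + T) has_vector_derivative 1) (at 0)"
      by (auto intro!: derivative_eq_intros)
    then show ?thesis
      using vector_diff_chain_at[of "\<lambda>s. s + T" 1 0 \<sigma> "v T"] v[OF I(2)] by (simp add: o_def)
  qed
  then have "((\<lambda>s. d \<otimes>\<^bsub>heis\<^esub> \<sigma> s) has_vector_derivative v T) (at 0)"
    using pos deck by (elim has_vector_derivative_transform_within_open[where S = "{-e<..<e}"]) auto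
  moreover have "((\<lambda>s. d \<otimes>\<^bsub>heis\<^esub> \<sigma> s) has_vector_derivative left_diff d (\<sigma> 0) (v 0)) (at 0)"
    unfolding left_diff heis_mult using v[OF I(1)]
      bounded_linear.has_vector_derivative[OF area.bounded_linear_right v[OF I(1)], of d]
    by (auto intro!: derivative_eq_intros simp: has_real_derivative_iff_has_vector_derivative)
  ultimately have vT: "v T = left_diff d (\<sigma> 0) (v 0)"
    by (rule vector_derivative_unique_at)
  \<comment> \<open>Translation by \<open>d\<close> preserves the metric and fixes
    \<open>e3\<close>, so in the momentum of \<open>e3\<close> only the \<open>Om\<close> term could
    change.\<close>
  have "g (\<sigma> T) (v T) e3 = g (\<sigma> 0) (v 0) e3"
    using g_left[of d "\<sigma> 0" "v 0" e3] unfolding \<sigma>T vT by (simp add: left_diff)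
  then have "Om (\<sigma> T) e3 = Om (\<sigma> 0) e3"
    using eq[of e3] by simp
  then have "Om d e3 = 0"
    by (simp add: \<sigma>T heis_mult Om.add_left Om.scaleR_left)
  with irr have d: "d = d$3 *\<^sub>R e3"
    by (simp add: vec3_eq_iff axis_def)
  \<comment> \<open>A central \<open>d\<close> acts as a Euclidean translation with identity
    differential, and the metric does not depend on the last coordinate. Hence only
    \<open>Om d w\<close> survives when the momenta of \<open>w\<close> are compared.\<close>
  then have d_area: "area_form d w = 0" for w
    by (metis mult_zero_right real_scaleR_def area.scaleR_left area_form_e3(2))
  then have \<sigma>T': "\<sigma> T = d + \<sigma> 0" and vT': "v T = v 0"
    by (simp_all add: \<sigma>T vT heis_mult left_diff)
  have "Om d w = 0" for w
  proof -
    have "g (\<sigma> T) (v T) w = g (\<sigma> 0) (v 0) w"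
      unfolding \<sigma>T' vT' g_translate[of "d + _"] g_translate[of "\<sigma> 0"] by (simp add: area.add_left d_area)
    then show ?thesis
      using eq[of w] by (simp add: \<sigma>T' area.add_left d_area Om.add_left)
  qed
  then have "d$3 * Om e3 w = 0" for w
    by (metis d Om.scaleR_left real_scaleR_def)
  with nz d show ?thesis by fastforce
qed

end

section \<open>Quotients\<close>

lemma coset_eq_iff:
  assumes "subgroup \<Gamma> heis"
  shows "\<Gamma> #>\<^bsub>heis\<^esub> p = \<Gamma> #>\<^bsub>heis\<^esub> q \<longleftrightarrow> (\<exists>d\<in>\<Gamma>. p = d \<otimes>\<^bsub>heis\<^esub> q)"
proof
  assume "\<Gamma> #>\<^bsub>heis\<^esub> p = \<Gamma> #>\<^bsub>heis\<^esub> q"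
  moreover have "p \<in> \<Gamma> #>\<^bsub>heis\<^esub> p"
    using assms by (intro heis.rcos_self) auto
  ultimately show "\<exists>d\<in>\<Gamma>. p = d \<otimes>\<^bsub>heis\<^esub> q"
    by (auto simp: r_coset_def)
next
  assume "\<exists>d\<in>\<Gamma>. p = d \<otimes>\<^bsub>heis\<^esub> q"
  then obtain d where "d \<in> \<Gamma>" "p = d \<otimes>\<^bsub>heis\<^esub> q" by blast
  then show "\<Gamma> #>\<^bsub>heis\<^esub> p = \<Gamma> #>\<^bsub>heis\<^esub> q"
    using heis.coset_mult_assoc[of \<Gamma> d q] heis.coset_join2[OF _ assms, of d] by simp
qed

lemma coset_in_rcosets: "\<Gamma> #>\<^bsub>heis\<^esub> p \<in> rcosets\<^bsub>heis\<^esub> \<Gamma>"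
  by (auto simp: RCOSETS_def)

lemma topspace_heis_quotient: "topspace (heis_quotient \<Gamma>) = rcosets\<^bsub>heis\<^esub> \<Gamma>"
proof
  have "openin (heis_quotient \<Gamma>) (rcosets\<^bsub>heis\<^esub> \<Gamma>)"
    by (simp add: openin_heis_quotient coset_in_rcosets)
  then show "rcosets\<^bsub>heis\<^esub> \<Gamma> \<subseteq> topspace (heis_quotient \<Gamma>)"
    by (rule openin_subset)
qed (auto simp: topspace_def openin_heis_quotient)

lemma continuous_map_projection:
  "continuous_map euclidean (heis_quotient \<Gamma>) (\<lambda>p. \<Gamma> #>\<^bsub>heis\<^esub> p)"
  by (auto simp: continuous_map_def topspace_heis_quotient coset_in_rcosets openin_heis_quotient)

lemma compact_space_heis_quotient:
  assumes "compact C" and "\<And>p. \<exists>q\<in>C. \<Gamma> #>\<^bsub>heis\<^esub> p = \<Gamma> #>\<^bsub>heis\<^esub> q"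
  shows "compact_space (heis_quotient \<Gamma>)"
proof -
  have "compactin (heis_quotient \<Gamma>) ((\<lambda>p. \<Gamma> #>\<^bsub>heis\<^esub> p) ` C)"
    using assms(1) by (intro image_compactin[OF _ continuous_map_projection]) simp
  moreover have "(\<lambda>p. \<Gamma> #>\<^bsub>heis\<^esub> p) ` C = rcosets\<^bsub>heis\<^esub> \<Gamma>"
  proof
    show "rcosets\<^bsub>heis\<^esub> \<Gamma> \<subseteq> (\<lambda>p. \<Gamma> #>\<^bsub>heis\<^esub> p) ` C"
      using assms(2) by (auto simp: RCOSETS_def image_iff)
  qed (auto simp: coset_in_rcosets)
  ultimately show ?thesis
    by (simp add: compact_space_def topspace_heis_quotient)
qed

text \<open>The lifted loop is contracted to its base point along straight lines in
  \<open>real^3\<close>, and the contraction is projected. Every stage is a loop because the ends of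
  \<sigma> agree.\<close>

lemma null_homotopic_projected_loop:
  fixes \<sigma> :: "real \<Rightarrow> real^3"
  assumes cont: "continuous_on {0..1} \<sigma>" and loop: "\<sigma> 1 = \<sigma> 0"
    and c: "\<And>s. s \<in> {0..1} \<Longrightarrow> c s = \<Gamma> #>\<^bsub>heis\<^esub> \<sigma> s"
  shows "null_homotopic_loop (heis_quotient \<Gamma>) c"
proof -
  define h where "h = (\<lambda>z. \<Gamma> #>\<^bsub>heis\<^esub> ((1 - fst z) *\<^sub>R \<sigma> (snd z) + fst z *\<^sub>R \<sigma> 0))"
  have "continuous_on ({0..1} \<times> {0..1}) (\<lambda>z. (1 - fst z) *\<^sub>R \<sigma> (snd z) + fst z *\<^sub>R \<sigma> 0)"
    by (intro continuous_intros continuous_on_compose2[OF cont]) auto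
  then have "continuous_map (top_of_set ({0..1} \<times> {0..1})) euclidean
      (\<lambda>z. (1 - fst z) *\<^sub>R \<sigma> (snd z) + fst z *\<^sub>R \<sigma> 0)"
    by simp
  then have "continuous_map (top_of_set ({0..1} \<times> {0..1})) (heis_quotient \<Gamma>) h"
    using continuous_map_compose[OF _ continuous_map_projection] unfolding h_def o_def by blast
  then have "homotopic_with (\<lambda>r. r 1 = r 0) (top_of_set {0..1}) (heis_quotient \<Gamma>) c
      (\<lambda>_. \<Gamma> #>\<^bsub>heis\<^esub> \<sigma> 0)"
    by (subst homotopic_with) (auto intro!: exI[of _ h] simp: h_def c loop)
  then show ?thesis unfolding null_homotopic_loop_def by blast
qed

text \<open>The quotient \<open>D\<close> of two lifts is continuous with values in a discrete
  group, hence constant on a connected set.\<close>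

lemma lifts_differ_by_deck_translation:
  fixes \<sigma> \<tau> :: "real \<Rightarrow> real^3"
  assumes \<Gamma>: "subgroup \<Gamma> heis" "discrete \<Gamma>" and J: "connected J" "J \<noteq> {}"
    and cont: "continuous_on J \<sigma>" "continuous_on J \<tau>"
    and eq: "\<And>s. s \<in> J \<Longrightarrow> \<Gamma> #>\<^bsub>heis\<^esub> \<sigma> s = \<Gamma> #>\<^bsub>heis\<^esub> \<tau> s"
  shows "\<exists>d\<in>\<Gamma>. \<forall>s\<in>J. \<sigma> s = d \<otimes>\<^bsub>heis\<^esub> \<tau> s"
proof -
  define D where "D s = \<sigma> s \<otimes>\<^bsub>heis\<^esub> inv\<^bsub>heis\<^esub> \<tau> s" for s
  have D: "\<sigma> s = D s \<otimes>\<^bsub>heis\<^esub> \<tau> s" for s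
    by (simp add: D_def heis.m_assoc)
  have D_in: "D s \<in> \<Gamma>" if "s \<in> J" for s
    using eq[OF that] coset_eq_iff[OF \<Gamma>(1)] by (auto simp: D_def heis.m_assoc)
  have "continuous_on J D"
    unfolding D_def heis_inv heis_mult using cont
    by (intro continuous_intros area.continuous_on) auto
  then have conn: "connected (D ` J)"
    using J(1) connected_continuous_image by blast
  obtain s0 where s0: "s0 \<in> J" using J(2) by blast
  have "\<not> D s0 islimpt \<Gamma>"
    using \<Gamma>(2) D_in[OF s0] unfolding discrete_def isolated_in_islimpt_iff by blast
  then have "\<not> D s0 islimpt D ` J"
    using D_in by (meson image_subsetI islimpt_subset)
  \<comment> \<open>In a connected set with more than one point, every point is a limit
    point.\<close>
  then obtain d where "D ` J = {d}"
    using connected_imp_perfect[OF conn, of "D s0"] s0 by blast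
  then have "D s = d" if "s \<in> J" for s using that by blast
  then show ?thesis using D D_in s0 by metis
qed

section \<open>A lattice adapted to a linear functional\<close>

text \<open>The first two coordinates are the coefficients \<open>m\<close>, \<open>n\<close> for which the functional
  \<open>a p$1 + b p$2\<close> takes the value \<open>m + x n\<close>; for irrational \<open>x\<close> it does not vanish at integer
  coefficients other than 0. The scaling of the last coordinate makes the cocycle integral.\<close>

definition lat_coord :: "real \<Rightarrow> real \<Rightarrow> real \<Rightarrow> real^3 \<Rightarrow> real^3" where
  "lat_coord x a b p = vector [a * p$1 + b * p$2 - x * (a * p$2 - b * p$1), a * p$2 - b * p$1,
     2 * (a\<^sup>2 + b\<^sup>2) * p$3]"

text \<open>The inverse of \<open>lat_coord\<close> for \<open>a\<^sup>2 + b\<^sup>2\<close>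
  nonzero: it solves \<open>a p$1 + b p$2 = v$1 + x v$2\<close> and
  \<open>a p$2 - b p$1 = v$2\<close>.\<close>

definition lat_point :: "real \<Rightarrow> real \<Rightarrow> real \<Rightarrow> real^3 \<Rightarrow> real^3" where
  "lat_point x a b v = vector [(a * (v$1 + x * v$2) - b * v$2) / (a\<^sup>2 + b\<^sup>2),
     (b * (v$1 + x * v$2) + a * v$2) / (a\<^sup>2 + b\<^sup>2), v$3 / (2 * (a\<^sup>2 + b\<^sup>2))]"

definition adapted_lattice :: "real \<Rightarrow> real \<Rightarrow> real \<Rightarrow> (real^3) set" where
  "adapted_lattice x a b = {p. \<forall>i. lat_coord x a b p $ i \<in> \<int>}"

lemma two_area_form: "2 * area_form u v = u$1 * v$2 - v$1 * u$2"
  by (simp add: area_form_def)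

text \<open>The planar part of \<open>lat_coord\<close> has determinant
  \<open>a\<^sup>2 + b\<^sup>2\<close>, by which areas scale. The factor on the last coordinate
  absorbs this and leaves the cocycle \<open>2 * area_form\<close>, which is integral on integer
  vectors.\<close>

lemma lat_coord_mult: "lat_coord x a b (p \<otimes>\<^bsub>heis\<^esub> q)
    = lat_coord x a b p + lat_coord x a b q + (2 * area_form (lat_coord x a b p) (lat_coord x a b q)) *\<^sub>R e3"
proof -
  have "2 * (a\<^sup>2 + b\<^sup>2) * area_form p q = 2 * area_form (lat_coord x a b p) (lat_coord x a b q)"
    by (simp add: area_form_def lat_coord_def field_simps power2_eq_square)
  then show ?thesis
    by (simp add: vec3_eq_iff heis_mult lat_coord_def axis_def algebra_simps)
qed

lemma linear_lat_coord: "linear (lat_coord x a b)"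
  by (rule linearI) (simp_all add: vec3_eq_iff lat_coord_def algebra_simps)

lemma linear_lat_point: "linear (lat_point x a b)"
  by (rule linearI)
     (simp_all add: vec3_eq_iff lat_point_def algebra_simps add_divide_distrib diff_divide_distrib)

context
  fixes x a b :: real
  assumes nz: "a\<^sup>2 + b\<^sup>2 \<noteq> 0"
begin

lemma lat_coord_point [simp]: "lat_coord x a b (lat_point x a b v) = v"
proof -
  define N where "N = a\<^sup>2 + b\<^sup>2"
  have "N \<noteq> 0" using nz unfolding N_def .
  then show ?thesis
    by (simp add: vec3_eq_iff lat_coord_def lat_point_def N_def[symmetric] divide_simps)
       (simp add: N_def algebra_simps power2_eq_square)
qed

lemma lat_point_coord [simp]: "lat_point x a b (lat_coord x a b p) = p"
proof -
  define N where "N = a\<^sup>2 + b\<^sup>2"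
  have "N \<noteq> 0" using nz unfolding N_def .
  then show ?thesis
    by (simp add: vec3_eq_iff lat_coord_def lat_point_def N_def[symmetric] divide_simps)
       (simp add: N_def algebra_simps power2_eq_square)
qed

lemma subgroup_adapted_lattice: "subgroup (adapted_lattice x a b) heis"
proof (rule heis.subgroupI)
  have "0 \<in> adapted_lattice x a b" by (simp add: adapted_lattice_def linear_0[OF linear_lat_coord])
  then show "adapted_lattice x a b \<noteq> {}" by blast
next
  fix p assume "p \<in> adapted_lattice x a b"
  then show "inv\<^bsub>heis\<^esub> p \<in> adapted_lattice x a b"
    by (simp add: adapted_lattice_def heis_inv linear_neg[OF linear_lat_coord])
next
  fix p q assume "p \<in> adapted_lattice x a b" "q \<in> adapted_lattice x a b"
  then show "p \<otimes>\<^bsub>heis\<^esub> q \<in> adapted_lattice x a b"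
    by (auto simp: adapted_lattice_def lat_coord_mult two_area_form axis_def)
qed simp

lemma discrete_adapted_lattice: "discrete (adapted_lattice x a b)"
  unfolding discrete_def
proof
  fix p assume p: "p \<in> adapted_lattice x a b"
  let ?f = "lat_coord x a b"
  let ?U = "{q. \<forall>i. \<bar>?f q $ i - ?f p $ i\<bar> < 1}"
  have cont: "continuous_on UNIV (\<lambda>q. \<bar>?f q $ i - ?f p $ i\<bar>)" for i
    using linear_continuous_on[OF linear_conv_bounded_linear[THEN iffD1, OF linear_lat_coord]]
    by (intro continuous_intros)
  have "?U = (\<Inter>i\<in>UNIV. {q. \<bar>?f q $ i - ?f p $ i\<bar> < 1})" by auto
  moreover have "open {q. \<bar>?f q $ i - ?f p $ i\<bar> < 1}" for i
    using open_Collect_less[OF cont continuous_on_const] .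
  ultimately have "open ?U" by auto
  moreover have "?U \<inter> adapted_lattice x a b = {p}"
  proof -
    have "q = p" if q: "q \<in> ?U" "q \<in> adapted_lattice x a b" for q
    proof -
      have "?f q $ i = ?f p $ i" for i
        using p q Ints_eq_abs_less1[of "?f q $ i" "?f p $ i"] by (simp add: adapted_lattice_def)
      then have "?f q = ?f p" by (simp add: vec_eq_iff)
      then show ?thesis by (metis lat_point_coord)
    qed
    then show ?thesis using p by auto
  qed
  ultimately show "p isolated_in adapted_lattice x a b"
    using p isolated_inI by blast
qed

lemma compact_quotient_adapted_lattice: "compact_space (heis_quotient (adapted_lattice x a b))"
proof (rule compact_space_heis_quotient)
  show "compact (lat_point x a b ` cbox 0 1)"
    by (intro compact_continuous_image linear_continuous_on compact_cbox
        linear_conv_bounded_linear[THEN iffD1, OF linear_lat_point])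
next
  fix p
  let ?f = "lat_coord x a b" and ?\<Gamma> = "adapted_lattice x a b"
  \<comment> \<open>Translating by \<open>m\<close> brings the first two coordinates into the unit
    box but shifts the third by the cocycle, so \<open>k\<close> takes the floor after adding that
    shift. Overwriting the third entry in \<open>m'\<close> is harmless since
    \<open>area_form\<close> ignores it.\<close>
  define m where "m = ((\<chi> i. - of_int \<lfloor>?f p $ i\<rfloor>) :: real^3)"
  define k where "k = (- of_int \<lfloor>?f p $ 3 + 2 * area_form m (?f p)\<rfloor> :: real)"
  define m' where "m' = ((\<chi> i. if i = 3 then k else m $ i) :: real^3)"
  define d where "d = lat_point x a b m'"
  have "d \<in> ?\<Gamma>"
    by (auto simp: adapted_lattice_def d_def m'_def m_def k_def)
  moreover have "d \<otimes>\<^bsub>heis\<^esub> p \<in> lat_point x a b ` cbox 0 1"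
  proof (rule image_eqI)
    have [simp]: "area_form m' (?f p) = area_form m (?f p)" by (simp add: area_form_def m'_def)
    have "?f (d \<otimes>\<^bsub>heis\<^esub> p) $ i \<in> {0..1}" for i
      using exhaust_3[of i]
      by (auto simp: lat_coord_mult d_def axis_def)
        (auto simp: m'_def m_def k_def; linarith)+
    then show "?f (d \<otimes>\<^bsub>heis\<^esub> p) \<in> cbox 0 1"
      by (simp add: mem_box_cart)
  qed simp
  ultimately show "\<exists>q\<in>lat_point x a b ` cbox 0 1. ?\<Gamma> #>\<^bsub>heis\<^esub> p = ?\<Gamma> #>\<^bsub>heis\<^esub> q"
    using coset_eq_iff[OF subgroup_adapted_lattice] by blast
qed

lemma heis_lattice_adapted_lattice: "heis_lattice (adapted_lattice x a b)"
  by (simp add: heis_lattice_def subgroup_adapted_lattice discrete_adapted_lattice compact_quotient_adapted_lattice)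

lemma adapted_lattice_kernel:
  assumes "x \<notin> \<rat>" "p \<in> adapted_lattice x a b" "a * p$1 + b * p$2 = 0"
  shows "p$1 = 0 \<and> p$2 = 0"
proof -
  let ?f = "lat_coord x a b"
  have f12: "?f p $ 1 = - x * ?f p $ 2"
    using assms(3) by (simp add: lat_coord_def)
  have Q: "?f p $ 1 \<in> \<rat>" "?f p $ 2 \<in> \<rat>"
    using assms(2) Ints_subset_Rats by (auto simp: adapted_lattice_def)
  have "?f p $ 2 = 0"
  proof (rule ccontr)
    assume "?f p $ 2 \<noteq> 0"
    then have "x = - (?f p $ 1) / ?f p $ 2" using f12 by simp
    moreover have "- (?f p $ 1) / ?f p $ 2 \<in> \<rat>" using Q by simp
    ultimately show False using assms(1) by simp
  qed
  then have "p = lat_point x a b (vector [0, 0, ?f p $ 3])"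
    using f12 by (subst lat_point_coord[symmetric], intro arg_cong[of _ _ "lat_point x a b"])
      (simp add: vec3_eq_iff)
  then show ?thesis
    by (metis (no_types, lifting) add_0 diff_zero div_0 lat_point_def mult_zero_right vector_3)
qed

end

section \<open>Lifting trajectories\<close>

context heis_magnetic
begin

text \<open>The lift lives on an open interval exceeding \<open>{a..b}\<close>, so that it is
  differentiable at the ends and consecutive lifts overlap.\<close>

definition lifts :: "(real^3) set \<Rightarrow> (real \<Rightarrow> (real^3) set) \<Rightarrow> real \<Rightarrow> real \<Rightarrow> bool" where
  "lifts \<Gamma> \<gamma> a b \<longleftrightarrow> (\<exists>e>0. \<exists>\<sigma>. magnetic_on g F {a - e<..<b + e} \<sigma> \<and>
     (\<forall>s\<in>{a - e<..<b + e}. \<gamma> s = \<Gamma> #>\<^bsub>heis\<^esub> \<sigma> s))"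

lemma magnetic_on_continuous: "magnetic_on g F I \<sigma> \<Longrightarrow> continuous_on I \<sigma>"
  unfolding magnetic_on_def
  by (meson continuous_at_imp_continuous_on has_vector_derivative_continuous)

text \<open>Near \<open>b\<close> the two lifts differ by a fixed lattice element \<open>d\<close>.
  Translating the second lift by \<open>d\<close> changes neither its projection nor the equation,
  and the two then fit together.\<close>

lemma lifts_trans:
  assumes \<Gamma>: "subgroup \<Gamma> heis" "discrete \<Gamma>"
    and "lifts \<Gamma> \<gamma> a b" "lifts \<Gamma> \<gamma> b c" "a \<le> b" "b \<le> c"
  shows "lifts \<Gamma> \<gamma> a c"
proof -
  obtain e1 \<sigma> where 1: "e1 > 0" "magnetic_on g F {a - e1<..<b + e1} \<sigma>"
    "\<And>s. s \<in> {a - e1<..<b + e1} \<Longrightarrow> \<gamma> s = \<Gamma> #>\<^bsub>heis\<^esub> \<sigma> s"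
    using assms(3) unfolding lifts_def by blast
  obtain e2 \<tau> where 2: "e2 > 0" "magnetic_on g F {b - e2<..<c + e2} \<tau>"
    "\<And>s. s \<in> {b - e2<..<c + e2} \<Longrightarrow> \<gamma> s = \<Gamma> #>\<^bsub>heis\<^esub> \<tau> s"
    using assms(4) unfolding lifts_def by blast
  define e where "e = min e1 e2"
  have e: "e > 0" "e \<le> e1" "e \<le> e2" using 1(1) 2(1) by (auto simp: e_def)
  let ?J = "{b - e<..<b + e}"
  have "\<exists>d\<in>\<Gamma>. \<forall>s\<in>?J. \<sigma> s = d \<otimes>\<^bsub>heis\<^esub> \<tau> s"
  proof (rule lifts_differ_by_deck_translation[OF \<Gamma>])
    show "continuous_on ?J \<sigma>" "continuous_on ?J \<tau>"
      using e assms(5,6)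
      by (auto intro!: continuous_on_subset[OF magnetic_on_continuous[OF 1(2)]]
          continuous_on_subset[OF magnetic_on_continuous[OF 2(2)]])
    show "\<Gamma> #>\<^bsub>heis\<^esub> \<sigma> s = \<Gamma> #>\<^bsub>heis\<^esub> \<tau> s" if "s \<in> ?J" for s
      using that 1(3)[of s] 2(3)[of s] e assms(5,6) by auto
  qed (use e in auto)
  then obtain d where d: "d \<in> \<Gamma>" "\<And>s. s \<in> ?J \<Longrightarrow> \<sigma> s = d \<otimes>\<^bsub>heis\<^esub> \<tau> s" by blast
  define \<rho> where "\<rho> s = (if s < b then \<sigma> s else d \<otimes>\<^bsub>heis\<^esub> \<tau> s)" for s
  have "magnetic_on g F {a - e<..<b + e} \<rho>"
    by (rule magnetic_on_cong[OF magnetic_on_subset[OF 1(2)]]) (use e d(2) in \<open>auto simp: \<rho>_def\<close>)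
  moreover have "magnetic_on g F {b - e<..<c + e} \<rho>"
    by (rule magnetic_on_cong[OF magnetic_on_subset[OF magnetic_on_translate[OF 2(2), of d]]])
       (use e d(2) in \<open>auto simp: \<rho>_def\<close>)
  moreover have "{a - e<..<b + e} \<union> {b - e<..<c + e} = {a - e<..<c + e}"
    using e assms(5,6) by auto
  ultimately have "magnetic_on g F {a - e<..<c + e} \<rho>"
    using magnetic_on_Un[of "{a - e<..<b + e}" \<rho> "{b - e<..<c + e}"] by simp
  moreover have "\<gamma> s = \<Gamma> #>\<^bsub>heis\<^esub> \<rho> s" if s: "s \<in> {a - e<..<c + e}" for s
  proof (cases "s < b")
    case True
    then show ?thesis using s 1(3)[of s] e by (simp add: \<rho>_def)
  next
    case False
    then have "\<gamma> s = \<Gamma> #>\<^bsub>heis\<^esub> \<tau> s" using s 2(3)[of s] e by simp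
    also have "\<dots> = \<Gamma> #>\<^bsub>heis\<^esub> (d \<otimes>\<^bsub>heis\<^esub> \<tau> s)"
      by (rule sym) (use d(1) coset_eq_iff[OF \<Gamma>(1)] in blast)
    finally show ?thesis using False by (simp add: \<rho>_def)
  qed
  ultimately show ?thesis unfolding lifts_def using e(1) by blast
qed

text \<open>Path lifting by bisection: local lifts exist by the definition of a trajectory, and
  \<open>lifts_trans\<close> joins adjacent ones.\<close>

lemma lifts_exist:
  assumes \<Gamma>: "subgroup \<Gamma> heis" "discrete \<Gamma>"
    and traj: "quotient_magnetic_trajectory g F \<Gamma> \<gamma>" and "a \<le> b"
  shows "lifts \<Gamma> \<gamma> a b"
  using \<open>a \<le> b\<close>
proof (induction rule: Bolzano)
  case (trans a b c)
  then show ?case using lifts_trans[OF \<Gamma>] by blast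
next
  case (local x)
  obtain \<epsilon> \<sigma> where \<epsilon>: "\<epsilon> > 0" and \<sigma>: "magnetic_on g F {x - \<epsilon><..<x + \<epsilon>} \<sigma>"
    "\<And>s. s \<in> {x - \<epsilon><..<x + \<epsilon>} \<Longrightarrow> \<gamma> s = \<Gamma> #>\<^bsub>heis\<^esub> \<sigma> s"
    using traj unfolding quotient_magnetic_trajectory_def by meson
  \<comment> \<open>Length below \<open>\<epsilon> / 2\<close> together with a margin of
    \<open>\<epsilon> / 2\<close> stays inside the domain of the local lift.\<close>
  have "lifts \<Gamma> \<gamma> u v" if "u \<le> x" "x \<le> v" "v - u < \<epsilon> / 2" for u v
  proof -
    have sub: "{u - \<epsilon> / 2<..<v + \<epsilon> / 2} \<subseteq> {x - \<epsilon><..<x + \<epsilon>}"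
      using that by auto
    show ?thesis
      unfolding lifts_def
      using \<epsilon> magnetic_on_subset[OF \<sigma>(1) sub] \<sigma>(2) subsetD[OF sub]
      by (intro exI[of _ "\<epsilon> / 2"] conjI exI[of _ \<sigma>]) simp_all
  qed
  then show ?case using \<epsilon> by (intro exI[of _ "\<epsilon> / 2"]) auto
qed

lemma closed_trajectory_null_homotopic:
  assumes \<Gamma>: "subgroup \<Gamma> heis" "discrete \<Gamma>"
    and irr: "\<And>d. d \<in> \<Gamma> \<Longrightarrow> Om d e3 = 0 \<Longrightarrow> d$1 = 0 \<and> d$2 = 0"
    and nz: "\<exists>u. Om e3 u \<noteq> 0"
    and traj: "quotient_magnetic_trajectory g F \<Gamma> \<gamma>" and T: "is_period T \<gamma>"
  shows "null_homotopic_loop (heis_quotient \<Gamma>) (\<lambda>s. \<gamma> (T * s))"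
proof -
  have "T > 0" and per: "\<gamma> (t + T) = \<gamma> t" for t
    using T unfolding is_period_def by blast+
  then have "lifts \<Gamma> \<gamma> 0 T"
    using lifts_exist[OF \<Gamma> traj] by simp
  then obtain e \<sigma> where e: "e > 0" and mag: "magnetic_on g F {-e<..<T + e} \<sigma>"
    and lift: "\<And>s. s \<in> {-e<..<T + e} \<Longrightarrow> \<gamma> s = \<Gamma> #>\<^bsub>heis\<^esub> \<sigma> s"
    unfolding lifts_def by auto
  note cont = magnetic_on_continuous[OF mag]
  \<comment> \<open>By periodicity, \<sigma> and its shift by \<open>T\<close> lift the same arc
    near 0.\<close>
  have "\<exists>d\<in>\<Gamma>. \<forall>s\<in>{-e<..<e}. \<sigma> (s + T) = d \<otimes>\<^bsub>heis\<^esub> \<sigma> s"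
  proof (rule lifts_differ_by_deck_translation[OF \<Gamma>])
    show "continuous_on {-e<..<e} \<sigma>"
      by (rule continuous_on_subset[OF cont]) (use \<open>T > 0\<close> in auto)
    show "continuous_on {-e<..<e} (\<lambda>s. \<sigma> (s + T))"
      by (rule continuous_on_compose2[OF cont]) (use \<open>T > 0\<close> in \<open>auto intro!: continuous_intros\<close>)
    show "\<Gamma> #>\<^bsub>heis\<^esub> \<sigma> (s + T) = \<Gamma> #>\<^bsub>heis\<^esub> \<sigma> s" if "s \<in> {-e<..<e}" for s
      using that \<open>T > 0\<close> lift[of s] lift[of "s + T"] per[of s] by simp
  qed (use e in auto)
  then obtain d where d: "d \<in> \<Gamma>" "\<And>s. s \<in> {-e<..<e} \<Longrightarrow> \<sigma> (s + T) = d \<otimes>\<^bsub>heis\<^esub> \<sigma> s" by blast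
  have "d = 0"
    using deck_translation_trivial[OF mag e \<open>T > 0\<close> d(2) irr[OF d(1)] nz] by blast
  then have "\<sigma> T = \<sigma> 0"
    using d(2)[of 0] e by (simp add: heis_mult area.zero_left)
  show ?thesis
  proof (rule null_homotopic_projected_loop[of "\<lambda>s. \<sigma> (T * s)"])
    have in_dom: "T * s \<in> {-e<..<T + e}" if "s \<in> {0..1}" for s
    proof -
      have "0 \<le> T * s" "T * s \<le> T"
        using that \<open>T > 0\<close> by (auto simp: mult_left_le)
      then show ?thesis using e by auto
    qed
    then show "continuous_on {0..1} (\<lambda>s. \<sigma> (T * s))"
      by (intro continuous_on_compose2[OF cont]) (auto intro!: continuous_intros)
    show "\<gamma> (T * s) = \<Gamma> #>\<^bsub>heis\<^esub> \<sigma> (T * s)" if "s \<in> {0..1}" for s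
      using lift in_dom that by blast
  qed (simp add: \<open>\<sigma> T = \<sigma> 0\<close>)
qed

section \<open>Forces vanishing on the center\<close>

lemma center_perp: "center_perp g = {v. g 0 v e3 = 0}"
proof -
  have "g 0 v z = z$3 * g 0 v e3" if "z \<in> lie_center" for v z
  proof -
    have "z = z$3 *\<^sub>R e3" using that by (simp add: lie_center vec3_eq_iff axis_def)
    then show ?thesis by (metis g.scaleR_right real_scaleR_def)
  qed
  moreover have "e3 \<in> lie_center" by (simp add: lie_center axis_def)
  ultimately have "(\<forall>z\<in>lie_center. g 0 v z = 0) \<longleftrightarrow> g 0 v e3 = 0" for v
    by (metis mult_zero_right)
  then show ?thesis unfolding center_perp_def heis_one by simp
qed

text \<open>The contrapositive yields the nonvanishing of \<open>Om e3\<close>. If \<open>F\<close>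
  kills the center, skewness puts its image into \<open>center_perp g\<close>, and a skew map of a
  Euclidean plane is a multiple of the quarter turn.\<close>

lemma is_force_F0_if_center_kernel:
  assumes Om: "\<And>u. Om e3 u = 0"
  shows "\<exists>\<rho>. is_force_F0 g \<rho> F"
proof -
  have Fe3: "F 0 e3 = 0"
    using Om g_nondegenerate[of 0 "F 0 e3" 0] by (simp add: Om_def g.zero_left)
  have F_center: "F 0 z = 0" if "z \<in> lie_center" for z
  proof -
    have "z = z$3 *\<^sub>R e3" using that by (simp add: lie_center vec3_eq_iff axis_def)
    then show ?thesis using linear_scale[OF linear_F, of 0 "z$3" e3] Fe3 by simp
  qed
  have pos33: "g 0 e3 e3 > 0" by (rule g_pos) (simp add: axis_eq_0_iff)
  \<comment> \<open>The coordinate vectors are made orthogonal to \<open>e3\<close>; Gram-Schmidt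
    then turns \<open>f 1\<close> and \<open>f 2\<close> into \<open>E1\<close> and
    \<open>E2\<close>.\<close>
  define f where "f i = axis i 1 - (g 0 (axis i 1) e3 / g 0 e3 e3) *\<^sub>R e3" for i :: 3
  have f_perp: "g 0 (f i) e3 = 0" for i
    using pos33 by (simp add: f_def g.diff_left g.scaleR_left)
  define E1 where "E1 = (1 / sqrt (g 0 (f 1) (f 1))) *\<^sub>R f 1"
  define h where "h = f 2 - g 0 (f 2) E1 *\<^sub>R E1"
  define E2 where "E2 = (1 / sqrt (g 0 h h)) *\<^sub>R h"
  have "f 1 $ 1 = 1" by (simp add: f_def axis_def)
  then have f1_pos: "g 0 (f 1) (f 1) > 0" by (intro g_pos) auto
  \<comment> \<open>\<open>E1\<close> has second coordinate 0, so \<open>h\<close> inherits the 1 of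
    \<open>f 2\<close> and cannot vanish.\<close>
  have "h $ 2 = 1" by (simp add: h_def E1_def f_def axis_def)
  then have h_pos: "g 0 h h > 0" by (intro g_pos) auto
  have E11: "g 0 E1 E1 = 1" using f1_pos by (simp add: E1_def g.scaleR_left g.scaleR_right)
  have E22: "g 0 E2 E2 = 1" using h_pos by (simp add: E2_def g.scaleR_left g.scaleR_right)
  have "g 0 h E1 = 0" by (simp add: h_def g.diff_left g.scaleR_left E11)
  then have E21: "g 0 E2 E1 = 0" by (simp add: E2_def g.scaleR_left)
  then have E12: "g 0 E1 E2 = 0" by (simp add: g_commute)
  have perp: "g 0 E1 e3 = 0" "g 0 E2 e3 = 0"
    by (simp_all add: E1_def E2_def h_def g.diff_left g.scaleR_left f_perp)
  have f1: "f 1 = sqrt (g 0 (f 1) (f 1)) *\<^sub>R E1" using f1_pos by (simp add: E1_def)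
  have f2: "f 2 = sqrt (g 0 h h) *\<^sub>R E2 + g 0 (f 2) E1 *\<^sub>R E1"
    using h_pos by (simp add: E2_def) (simp add: h_def)
  \<comment> \<open>The remainder \<open>r\<close> is orthogonal to \<open>E1\<close>,
    \<open>E2\<close> and \<open>e3\<close>, hence to all coordinate vectors, and so is
    zero.\<close>
  have expand: "v = g 0 v E1 *\<^sub>R E1 + g 0 v E2 *\<^sub>R E2" if v: "g 0 v e3 = 0" for v
  proof -
    define r where "r = v - (g 0 v E1 *\<^sub>R E1 + g 0 v E2 *\<^sub>R E2)"
    have r: "g 0 r E1 = 0" "g 0 r E2 = 0" "g 0 r e3 = 0"
      by (simp_all add: r_def g.diff_left g.add_left g.scaleR_left E11 E12 E21 E22 perp v)
    have "g 0 r (f 1) = 0"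
      by (subst f1) (simp add: g.scaleR_right r)
    then have r1: "g 0 r (axis 1 1) = 0"
      using r(3) by (simp add: f_def g.diff_right g.scaleR_right)
    have "g 0 r (f 2) = 0"
      by (subst f2) (simp add: g.scaleR_right g.add_right r)
    then have r2: "g 0 r (axis 2 1) = 0"
      using r(3) by (simp add: f_def g.diff_right g.scaleR_right)
    have "g 0 r w = 0" for w
      by (subst vec3_expand[of w]) (simp add: g.add_right g.scaleR_right r1 r2 r(3))
    then have "r = 0" using g_pos[of r 0] by force
    then show ?thesis by (simp add: r_def)
  qed
  have span: "span {E1, E2} = center_perp g"
  proof
    have "subspace (center_perp g)"
      unfolding center_perp
      by (auto intro!: subspaceI simp: g.add_left g.scaleR_left g.zero_left)
    then show "span {E1, E2} \<subseteq> center_perp g"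
      by (rule span_minimal[rotated]) (simp add: center_perp perp)
    show "center_perp g \<subseteq> span {E1, E2}"
    proof
      fix v assume "v \<in> center_perp g"
      then have "v = g 0 v E1 *\<^sub>R E1 + g 0 v E2 *\<^sub>R E2"
        using expand by (simp add: center_perp)
      moreover have "g 0 v E1 *\<^sub>R E1 + g 0 v E2 *\<^sub>R E2 \<in> span {E1, E2}"
        by (intro span_add span_scale span_base) auto
      ultimately show "v \<in> span {E1, E2}" by simp
    qed
  qed
  have F_perp: "g 0 (F 0 u) e3 = 0" for u
    by (simp add: F_skew Fe3 g.zero_right)
  have F_self: "g 0 (F 0 u) u = 0" for u
    unfolding Om_def[symmetric] by (rule Om_self)
  define \<rho> where "\<rho> = g 0 (F 0 E1) E2"
  have "F 0 E1 = \<rho> *\<^sub>R E2"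
    using expand[OF F_perp[of E1]] by (simp add: F_self \<rho>_def)
  moreover have "g 0 (F 0 E2) E1 = - \<rho>"
    using Om_skew[of E2 E1] by (simp add: Om_def \<rho>_def)
  then have "F 0 E2 = - \<rho> *\<^sub>R E1"
    using expand[OF F_perp[of E2]] by (simp add: F_self)
  ultimately have "is_force_F0 g \<rho> F"
    unfolding is_force_F0_def heis_one using F_center span E11 E22 E12 by blast
  then show ?thesis ..
qed

end

section \<open>The lattice for a force not vanishing on the center\<close>

theorem corollary5p7:
  fixes g :: "real^3 \<Rightarrow> real^3 \<Rightarrow> real^3 \<Rightarrow> real"
    and F :: "real^3 \<Rightarrow> real^3 \<Rightarrow> real^3"
  assumes "left_invariant_metric g"
    and "left_invariant_lorentz_force g F"
    and "\<forall>\<rho>. \<not> is_force_F0 g \<rho> F"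
  shows "\<exists>\<Gamma>. heis_lattice \<Gamma> \<and>
           (\<forall>\<gamma> T. quotient_magnetic_trajectory g F \<Gamma> \<gamma> \<and> is_period T \<gamma> \<longrightarrow>
                  null_homotopic_loop (heis_quotient \<Gamma>) (\<lambda>s. \<gamma> (T * s)))"
proof -
  interpret heis_magnetic g F
    by unfold_locales (use assms in auto)
  obtain u where u: "Om e3 u \<noteq> 0"
    using is_force_F0_if_center_kernel assms(3) by blast
  \<comment> \<open>The coefficients of the functional \<open>Om _ e3\<close> on the plane, to which
    the lattice is adapted.\<close>
  define a where "a = Om (axis 1 1) e3"
  define b where "b = Om (axis 2 1) e3"
  have "Om u e3 \<noteq> 0" using u Om_skew[of u e3] by simp
  then have nz: "a\<^sup>2 + b\<^sup>2 \<noteq> 0"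
    by (auto simp: Om_e3[of u] a_def b_def sum_power2_eq_zero_iff)
  obtain x :: real where x: "x \<notin> \<rat>"
    using countable_rat uncountable_UNIV_real by (metis UNIV_eq_I countable_subset subset_UNIV)
  have "null_homotopic_loop (heis_quotient (adapted_lattice x a b)) (\<lambda>s. \<gamma> (T * s))"
    if "quotient_magnetic_trajectory g F (adapted_lattice x a b) \<gamma>" "is_period T \<gamma>" for \<gamma> T
  proof (rule closed_trajectory_null_homotopic[OF subgroup_adapted_lattice[OF nz] discrete_adapted_lattice[OF nz] _ _ that])
    show "d$1 = 0 \<and> d$2 = 0" if "d \<in> adapted_lattice x a b" "Om d e3 = 0" for d
    proof (rule adapted_lattice_kernel[OF nz x that(1)])
      show "a * d$1 + b * d$2 = 0"
        using that(2) unfolding Om_e3[of d] a_def b_def by (simp add: mult.commute)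
    qed
  qed (use u in blast)
  then show ?thesis using heis_lattice_adapted_lattice[OF nz] by blast
qed

end
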